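(* (1) Every trifactorised group $(G,K,H,E)$ is a trifactorised group associated with the skew left brace $\mathsf{B}(G,K,H,E)$. (2) Let $(B,+,\cdot)$ be a skew left brace and let $(G,K,H,E)$ be a trifactorised group associated with $(B,+,\cdot)$. Then $\mathsf{B}(G,K,H,E)=(B,+,\cdot)$.
   Context: A skew left brace $(B,+,\cdot)$ is a set with two group operations ($+$ not necessarily commutative) such that $a(b+c)=ab-a+ac$ for all $a,b,c\in B$. Its lambda map is the homomorphism $\lambda\colon (B,\cdot)\to\operatorname{Aut}(B,+)$, $\lambda_a(b)=-a+ab$. A trifactorised group is a tuple $(G,K,H,E)$ with $G$ a group, $K\trianglelefteq G$, $H,E\le G$, $G=KE=KH=HE$ and $K\cap E=H\cap E=1$. The associated brace $\mathsf{B}(G,K,H,E)$ of a trifactorised group is $(K,\cdot,\boxdot)$: its underlying set is $K$, its additive operation is the group operation of $K$ inherited from $G$, and its multiplicative operation is $k_1\boxdot k_2=k_1\,(e_{k_1}k_2e_{k_1}^{-1})$, where for $k\in K$, $e_k$ is the unique element of $E$ with $ke_k\in H$. This is a skew left brace. Trifactorised groups associated with a brace: let $K=(B,+)$, $C=(B,\cdot)$, let $\delta\colon C\to K$ be the identity map of $B$, and let $\eta\colon C\to E$ be a surjective group homomorphism with $\ker\eta\le\ker\lambda$. Then $E$ acts on $K$ by $\bar\lambda(\eta(c))=\lambda(c)$; put $G=K\rtimes E$ and $H=\{\delta(c)\eta(c)\mid c\in C\}\le G$. The tuple $(G,K,H,E)$ is called a trifactorised group associated with $B$. Here $K$ and $E$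 are identified with their copies in $G$ (so the set $B$ is identified with $K\le G$), and an internal semidirect product $G=KE$ is identified with the external one $K\rtimes E$ via $(k,e)\mapsto ke$; the equalities in the statement are with respect to these identifications. *)

theory Defs
  imports "HOL-Algebra.Algebra"
begin

text \<open>
  A skew left brace is carried by the record type of rings, used only for its signature:
  \<open>\<oplus>\<close> and \<open>\<otimes>\<close> are the two group operations, neither of which need be commutative.
  Note that \<open>a \<otimes> b \<ominus> a \<oplus> a \<otimes> c\<close> is read as \<open>((a \<otimes> b) \<oplus> (\<ominus> a)) \<oplus> (a \<otimes> c)\<close>.
\<close>

locale skew_left_brace =
  fixes B (structure)
  assumes additive_group: "group (add_monoid B)"
    and multiplicative_group: "group B"
    and brace_law: "\<lbrakk> a \<in> carrier B; b \<in> carrier B; c \<in> carrier B \<rbrakk>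
      \<Longrightarrow> a \<otimes> (b \<oplus> c) = a \<otimes> b \<ominus> a \<oplus> a \<otimes> c"

text \<open>The restriction to the carrier makes the values elements of \<open>AutoGroup (add_monoid B)\<close>.\<close>

definition lambda_map :: "('b, 'm) ring_scheme \<Rightarrow> 'b \<Rightarrow> 'b \<Rightarrow> 'b" where
  "lambda_map B a = (\<lambda>b \<in> carrier B. (\<ominus>\<^bsub>B\<^esub> a) \<oplus>\<^bsub>B\<^esub> (a \<otimes>\<^bsub>B\<^esub> b))"

locale trifactorised_group = group G for G (structure) +
  fixes K H E
  assumes normal_K: "K \<lhd> G"
    and subgroup_H: "subgroup H G"
    and subgroup_E: "subgroup E G"
    and G_eq_KE: "carrier G = K <#> E"
    and G_eq_KH: "carrier G = K <#> H"
    and G_eq_HE: "carrier G = H <#> E"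
    and K_Int_E: "K \<inter> E = {\<one>}"
    and H_Int_E: "H \<inter> E = {\<one>}"

text \<open>\<open>E_part G H E k\<close> is \<open>e\<^sub>k\<close>; it is well defined on \<open>K\<close> because \<open>G = H E\<close> and \<open>H \<inter> E = 1\<close>.\<close>

definition E_part :: "('g, 'm) monoid_scheme \<Rightarrow> 'g set \<Rightarrow> 'g set \<Rightarrow> 'g \<Rightarrow> 'g" where
  "E_part G H E k = (THE e. e \<in> E \<and> k \<otimes>\<^bsub>G\<^esub> e \<in> H)"

definition brace_of :: "('g, 'm) monoid_scheme \<Rightarrow> 'g set \<Rightarrow> 'g set \<Rightarrow> 'g set \<Rightarrow> 'g ring" where
  "brace_of G K H E =
    \<lparr> carrier = K,
      monoid.mult = (\<lambda>k\<^sub>1 k\<^sub>2. k\<^sub>1 \<otimes>\<^bsub>G\<^esub>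
        (E_part G H E k\<^sub>1 \<otimes>\<^bsub>G\<^esub> k\<^sub>2 \<otimes>\<^bsub>G\<^esub> inv\<^bsub>G\<^esub> (E_part G H E k\<^sub>1))),
      one = \<one>\<^bsub>G\<^esub>,
      ring.zero = \<one>\<^bsub>G\<^esub>,
      ring.add = (\<otimes>\<^bsub>G\<^esub>) \<rparr>"

definition semidirect_product ::
    "('a, 'm) monoid_scheme \<Rightarrow> ('e, 'n) monoid_scheme \<Rightarrow> ('e \<Rightarrow> 'a \<Rightarrow> 'a) \<Rightarrow> ('a \<times> 'e) monoid" where
  "semidirect_product A E \<phi> =
    \<lparr> carrier = carrier A \<times> carrier E,
      monoid.mult = (\<lambda>(a, e) (b, f). (a \<otimes>\<^bsub>A\<^esub> \<phi> e b, e \<otimes>\<^bsub>E\<^esub> f)),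
      one = (\<one>\<^bsub>A\<^esub>, \<one>\<^bsub>E\<^esub>) \<rparr>"

text \<open>
  The data from which an associated trifactorised group is built. The equation \<open>lambda_bar\<close>
  determines the action \<open>lambar\<close> on \<open>carrier E\<^sub>0\<close>, because \<open>\<eta>\<close> is surjective; such a \<open>lambar\<close> exists
  because \<open>ker \<eta> \<le> ker \<lambda>\<close>.
\<close>

locale brace_extension_data = skew_left_brace B + E: group E\<^sub>0
  for B :: "('b, 'm) ring_scheme" (structure) and E\<^sub>0 :: "('e, 'n) monoid_scheme" +
  fixes \<eta> :: "'b \<Rightarrow> 'e" and lambar :: "'e \<Rightarrow> 'b \<Rightarrow> 'b"
  assumes eta_hom: "\<eta> \<in> hom B E\<^sub>0"
    and eta_surj: "\<eta> ` carrier B = carrier E\<^sub>0"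
    and kernel_le: "kernel B E\<^sub>0 \<eta> \<subseteq> kernel B (AutoGroup (add_monoid B)) (lambda_map B)"
    and lambda_bar: "c \<in> carrier B \<Longrightarrow> lambar (\<eta> c) = lambda_map B c"

text \<open>
  The tuple \<open>(G, K, H, E)\<close> is a trifactorised group associated with \<open>B\<close>, where \<open>j\<close> is the
  isomorphism identifying the external semidirect product \<open>(B, +) \<rtimes> E\<^sub>0\<close> with \<open>G\<close>; in it,
  \<open>\<delta>(c)\<eta>(c)\<close> is the pair \<open>(c, \<eta> c)\<close>. The external tuple itself is the case where \<open>j\<close> is the
  identity. For an internal semidirect product, \<open>E\<^sub>0\<close> is \<open>E\<close> and \<open>j\<close> is \<open>(k, e) \<mapsto> k e\<close>.
\<close>

locale associated_trifactorised_group =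
  brace_extension_data B E\<^sub>0 \<eta> lambar + G: group G
  for G :: "('g, 'k) monoid_scheme" and K H E :: "'g set"
    and B :: "('b, 'm) ring_scheme" (structure) and E\<^sub>0 :: "('e, 'n) monoid_scheme"
    and \<eta> :: "'b \<Rightarrow> 'e" and lambar :: "'e \<Rightarrow> 'b \<Rightarrow> 'b" and j :: "'b \<times> 'e \<Rightarrow> 'g" +
  assumes j_iso: "j \<in> iso (semidirect_product (add_monoid B) E\<^sub>0 lambar) G"
    and K_eq: "K = j ` (carrier B \<times> {\<one>\<^bsub>E\<^sub>0\<^esub>})"
    and H_eq: "H = j ` {(c, \<eta> c) | c. c \<in> carrier B}"
    and E_eq: "E = j ` ({\<zero>} \<times> carrier E\<^sub>0)"

end

theory Submission
  imports Defs
begin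

text \<open>
  In any trifactorised group \<open>(G, K, H, E)\<close> the three factorisations say that \<open>H\<close> is the graph
  \<open>{k e\<^sub>k | k \<in> K}\<close> of a surjection \<open>k \<mapsto> e\<^sub>k\<close> from \<open>K\<close> onto \<open>E\<close>: it is defined on all of \<open>K\<close> because
  \<open>G = H E\<close>, single-valued because \<open>H \<inter> E = 1\<close>, onto because \<open>G = K H\<close>, and the graph exhausts
  \<open>H\<close> because \<open>G = K E\<close>. The product of two elements of the graph is
  \<open>(k e\<^sub>k)(l e\<^sub>l) = k (e\<^sub>k l e\<^sub>k\<^sup>-\<^sup>1) \<cdot> e\<^sub>k e\<^sub>l\<close>, so the multiplication of the brace is the
  multiplication of \<open>H\<close> read on first components, and \<open>k \<mapsto> e\<^sub>k\<close> is multiplicative for it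
  (\<open>E_part_mult\<close>). Moreover the lambda map of \<open>k\<close> is conjugation by \<open>e\<^sub>k\<close>
  (\<open>lambda_map_brace_of\<close>). Hence \<open>\<eta> = (k \<mapsto> e\<^sub>k)\<close> and the conjugation action of \<open>E\<close> on \<open>K\<close> are
  data from which \<open>G = K \<rtimes> E\<close> is built as a group associated with its own brace.

  Conversely, let \<open>G\<close> be identified with \<open>(B, +) \<rtimes> E\<^sub>0\<close>. Since \<open>a + \<lambda>\<^sub>a(b) = a b\<close>, the set \<open>H\<close> of
  pairs \<open>(c, \<eta> c)\<close> is the image of a homomorphism from the multiplicative group of \<open>B\<close>, and all
  requirements on a trifactorised group can be read off from the pairs. The pair
  \<open>(b, \<eta> b) = (b, 1)(0, \<eta> b)\<close> shows that \<open>e\<^sub>b = \<eta> b\<close>, which acts as \<open>\<lambda>\<^sub>b\<close>; thus the brace product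
  of \<open>a\<close> and \<open>b\<close> in \<open>K\<close> is \<open>a + \<lambda>\<^sub>a(b)\<close>, the original product (\<open>j_ring_iso\<close>).
\<close>

section \<open>Skew left braces\<close>

context skew_left_brace
begin

sublocale add: group "add_monoid B"
  rewrites "carrier (add_monoid B) = carrier B"
    and "monoid.mult (add_monoid B) = add B"
    and "monoid.one (add_monoid B) = \<zero>"
    and "m_inv (add_monoid B) = a_inv B"
  by (rule additive_group) (auto simp: a_inv_def)

sublocale mult: group B
  by (rule multiplicative_group)

text \<open>The brace law for \<open>1 (0 + 0)\<close> reads \<open>0 = 0 - 1 + 0\<close>.\<close>

lemma zero_eq_one: "\<zero> = \<one>"
proof -
  have "\<one> \<otimes> (\<zero> \<oplus> \<zero>) = \<one> \<otimes> \<zero> \<ominus> \<one> \<oplus> \<one> \<otimes> \<zero>"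
    by (rule brace_law) auto
  then have "\<ominus> \<one> = \<zero>"
    by (simp add: a_minus_def)
  then show ?thesis
    by (metis add.inv_eq_1_iff mult.one_closed)
qed

lemma lambda_map_closed:
  assumes "a \<in> carrier B" "b \<in> carrier B"
  shows "lambda_map B a b \<in> carrier B"
  using assms by (simp add: lambda_map_def)

lemma add_lambda_map:
  assumes "a \<in> carrier B" "b \<in> carrier B"
  shows "a \<oplus> lambda_map B a b = a \<otimes> b"
  using assms by (simp add: lambda_map_def add.inv_solve_left' flip: add.m_assoc)

lemma lambda_map_zero:
  assumes "a \<in> carrier B"
  shows "lambda_map B a \<zero> = \<zero>"
  using assms zero_eq_one mult.r_one[of a] by (simp add: lambda_map_def)

lemma lambda_map_one:
  assumes "b \<in> carrier B"
  shows "lambda_map B \<one> b = b"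
  using assms zero_eq_one add.inv_one by (simp add: lambda_map_def)

end


section \<open>The brace of a trifactorised group\<close>

lemma (in group) inv_mult_cancel:
  assumes "x \<in> carrier G" "y \<in> carrier G"
  shows "inv x \<otimes> (x \<otimes> y) = y" "x \<otimes> (inv x \<otimes> y) = y"
  using assms by (simp_all flip: m_assoc)

lemma (in group) trivial_Int_factors_unique:
  assumes "subgroup A G" "subgroup B G" "A \<inter> B = {\<one>}"
    and "a \<in> A" "b \<in> B" "a' \<in> A" "b' \<in> B" "a \<otimes> b = a' \<otimes> b'"
  shows "a = a'" "b = b'"
proof -
  interpret group_disjoint_sum G A B
    using assms by (simp add: group_disjoint_sum_def is_group)
  show "a = a'" "b = b'"
    using assms cancel by blast+
qed

context trifactorised_group
begin

sublocale K: normal K G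
  by (rule normal_K)

sublocale H: subgroup H G
  by (rule subgroup_H)

sublocale E: subgroup E G
  by (rule subgroup_E)

abbreviation e where "e \<equiv> E_part G H E"

abbreviation Br where "Br \<equiv> brace_of G K H E"

lemma E_part_unique_exists:
  assumes "k \<in> carrier G"
  shows "\<exists>!f. f \<in> E \<and> k \<otimes> f \<in> H"
proof (rule ex_ex1I)
  obtain h f where hf: "h \<in> H" "f \<in> E" "k = h \<otimes> f"
    using assms G_eq_HE unfolding set_mult_def by blast
  then have "k \<otimes> inv f = h"
    by (simp add: m_assoc)
  then show "\<exists>f. f \<in> E \<and> k \<otimes> f \<in> H"
    using hf by blast
next
  fix f f' assume f: "f \<in> E \<and> k \<otimes> f \<in> H" "f' \<in> E \<and> k \<otimes> f' \<in> H"
  then have "(k \<otimes> f) \<otimes> inv f = (k \<otimes> f') \<otimes> inv f'"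
    using assms by (simp add: m_assoc)
  then have "inv f = inv f'"
    using trivial_Int_factors_unique(2)[OF subgroup_H subgroup_E H_Int_E,
        of "k \<otimes> f" "inv f" "k \<otimes> f'" "inv f'"] f by simp
  then show "f = f'"
    using f inv_inj by (auto simp: inj_on_def)
qed

lemma E_part_props:
  assumes "k \<in> carrier G"
  shows E_part_in_E: "e k \<in> E" and mult_E_part_in_H: "k \<otimes> e k \<in> H"
  using theI'[OF E_part_unique_exists[OF assms]] by (auto simp: E_part_def)

lemma E_part_eqI:
  assumes "k \<in> carrier G" "f \<in> E" "k \<otimes> f \<in> H"
  shows "e k = f"
  using E_part_unique_exists[OF assms(1)] E_part_props[OF assms(1)] assms by blast

lemma E_part_in_carrier [simp]:
  assumes "k \<in> K"
  shows "e k \<in> carrier G"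
  using assms E_part_in_E by simp

lemma brace_of_sel [simp]:
  "carrier Br = K"
  "k \<otimes>\<^bsub>Br\<^esub> l = k \<otimes> (e k \<otimes> l \<otimes> inv (e k))"
  "\<one>\<^bsub>Br\<^esub> = \<one>" "\<zero>\<^bsub>Br\<^esub> = \<one>" "k \<oplus>\<^bsub>Br\<^esub> l = k \<otimes> l"
  by (simp_all add: brace_of_def)

lemma conj_E_part_closed:
  assumes "k \<in> K" "l \<in> K"
  shows "e k \<otimes> l \<otimes> inv (e k) \<in> K"
  using assms by (simp add: K.inv_op_closed2)

lemma brace_mult_closed:
  assumes "k \<in> K" "l \<in> K"
  shows "k \<otimes>\<^bsub>Br\<^esub> l \<in> K"
  using assms by (simp add: conj_E_part_closed)

text \<open>The defining property of \<open>e\<close> is checked on \<open>(k e\<^sub>k)(l e\<^sub>l) \<in> H\<close>, whose component in \<open>K\<close> is the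
  brace product.\<close>

lemma E_part_mult:
  assumes "k \<in> K" "l \<in> K"
  shows "e (k \<otimes>\<^bsub>Br\<^esub> l) = e k \<otimes> e l"
proof (rule E_part_eqI)
  show "k \<otimes>\<^bsub>Br\<^esub> l \<in> carrier G"
    by (rule K.mem_carrier[OF brace_mult_closed[OF assms]])
  show "e k \<otimes> e l \<in> E"
    using assms by (simp add: E_part_in_E)
  have "(k \<otimes>\<^bsub>Br\<^esub> l) \<otimes> (e k \<otimes> e l) = (k \<otimes> e k) \<otimes> (l \<otimes> e l)"
    using assms by (simp add: m_assoc inv_mult_cancel)
  then show "(k \<otimes>\<^bsub>Br\<^esub> l) \<otimes> (e k \<otimes> e l) \<in> H"
    using assms by (metis H.m_closed K.mem_carrier mult_E_part_in_H)
qed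

lemma E_part_one: "e \<one> = \<one>"
  by (rule E_part_eqI) auto

lemma brace_of_add_group: "group (add_monoid Br)"
proof (rule groupI)
  fix x assume "x \<in> carrier (add_monoid Br)"
  then show "\<exists>y\<in>carrier (add_monoid Br). y \<otimes>\<^bsub>add_monoid Br\<^esub> x = \<one>\<^bsub>add_monoid Br\<^esub>"
    by (intro bexI[of _ "inv x"]) auto
qed (auto simp: m_assoc)

lemma brace_of_mult_group: "group Br"
proof (rule groupI)
  fix x y z assume "x \<in> carrier Br" "y \<in> carrier Br" "z \<in> carrier Br"
  moreover from this have "e (x \<otimes>\<^bsub>Br\<^esub> y) = e x \<otimes> e y"
    by (simp only: E_part_mult brace_of_sel(1))
  ultimately show "x \<otimes>\<^bsub>Br\<^esub> y \<otimes>\<^bsub>Br\<^esub> z = x \<otimes>\<^bsub>Br\<^esub> (y \<otimes>\<^bsub>Br\<^esub> z)"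
    by (simp add: m_assoc inv_mult_group inv_mult_cancel)
next
  fix x assume x: "x \<in> carrier Br"
  \<comment> \<open>the component in \<open>K\<close> of \<open>(x e\<^sub>x)\<^sup>-\<^sup>1 = y e\<^sub>x\<^sup>-\<^sup>1\<close>\<close>
  define y where "y = inv (e x) \<otimes> inv x \<otimes> e x"
  have yK: "y \<in> K"
    using x K.inv_op_closed1 unfolding y_def by simp
  have "y \<otimes> inv (e x) = inv (x \<otimes> e x)"
    using x by (simp add: y_def m_assoc inv_mult_group)
  then have "e y = inv (e x)"
    using x yK by (intro E_part_eqI) (simp_all add: E_part_in_E mult_E_part_in_H)
  then have "y \<otimes>\<^bsub>Br\<^esub> x = \<one>\<^bsub>Br\<^esub>"
    using x by (simp add: y_def m_assoc inv_mult_cancel)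
  then show "\<exists>y\<in>carrier Br. y \<otimes>\<^bsub>Br\<^esub> x = \<one>\<^bsub>Br\<^esub>"
    using yK by auto
qed (auto simp: conj_E_part_closed E_part_one)

lemma brace_of_uminus:
  assumes "k \<in> K"
  shows "\<ominus>\<^bsub>Br\<^esub> k = inv k"
  unfolding a_inv_def
  by (rule group.inv_equality[OF brace_of_add_group]) (use assms in auto)

text \<open>Both sides of the brace law equal \<open>a e\<^sub>a b c e\<^sub>a\<^sup>-\<^sup>1\<close>.\<close>

lemma brace_of_skew_left_brace: "skew_left_brace Br"
proof (rule skew_left_brace.intro)
  show "group (add_monoid Br)" by (rule brace_of_add_group)
  show "group Br" by (rule brace_of_mult_group)
  fix a b c assume "a \<in> carrier Br" "b \<in> carrier Br" "c \<in> carrier Br"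
  then show "a \<otimes>\<^bsub>Br\<^esub> (b \<oplus>\<^bsub>Br\<^esub> c) = a \<otimes>\<^bsub>Br\<^esub> b \<ominus>\<^bsub>Br\<^esub> a \<oplus>\<^bsub>Br\<^esub> a \<otimes>\<^bsub>Br\<^esub> c"
    by (simp add: a_minus_def brace_of_uminus m_assoc inv_mult_cancel)
qed

lemma lambda_map_brace_of:
  assumes "a \<in> K" "b \<in> K"
  shows "lambda_map Br a b = e a \<otimes> b \<otimes> inv (e a)"
  using assms by (simp add: lambda_map_def brace_of_uminus m_assoc inv_mult_cancel)

text \<open>If \<open>f = k h\<close> with \<open>k \<in> K\<close> and \<open>h \<in> H\<close>, then \<open>k\<^sup>-\<^sup>1 f \<in> H\<close>, so \<open>f\<close> is the value at \<open>k\<^sup>-\<^sup>1\<close>.\<close>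

lemma E_part_image: "e ` K = E"
proof (intro equalityI subsetI)
  fix f assume f: "f \<in> E"
  then obtain k h where kh: "k \<in> K" "h \<in> H" "f = k \<otimes> h"
    using G_eq_KH E.mem_carrier unfolding set_mult_def by blast
  then have "inv k \<otimes> f = h"
    by (simp add: inv_mult_cancel)
  then have "e (inv k) = f"
    using kh f by (intro E_part_eqI) simp_all
  then show "f \<in> e ` K"
    using kh by (metis K.m_inv_closed imageI)
qed (auto simp: E_part_in_E)

text \<open>Restricted to \<open>K\<close> because the lambda map is undefined outside the carrier of the brace,
  and the two have to agree as functions.\<close>

abbreviation conj_on_K where
  "conj_on_K \<equiv> \<lambda>f. \<lambda>k\<in>K. f \<otimes> k \<otimes> inv f"

lemma brace_extension_data_brace_of:
  "brace_extension_data Br (G\<lparr>carrier := E\<rparr>) e conj_on_K"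
proof (intro brace_extension_data.intro brace_extension_data_axioms.intro)
  show "skew_left_brace Br"
    by (rule brace_of_skew_left_brace)
  show "group (G\<lparr>carrier := E\<rparr>)"
    by (rule E.subgroup_is_group[OF is_group])
  show "e \<in> hom Br (G\<lparr>carrier := E\<rparr>)"
    using E_part_mult by (auto simp: hom_def E_part_in_E simp del: brace_of_sel(2))
  show "e ` carrier Br = carrier (G\<lparr>carrier := E\<rparr>)"
    by (simp add: E_part_image)
  show "conj_on_K (e c) = lambda_map Br c" if "c \<in> carrier Br" for c
  proof
    show "conj_on_K (e c) k = lambda_map Br c k" for k
      using that by (cases "k \<in> K") (simp_all add: lambda_map_brace_of, simp add: lambda_map_def)
  qed
  show "kernel Br (G\<lparr>carrier := E\<rparr>) e \<subseteq> kernel Br (AutoGroup (add_monoid Br)) (lambda_map Br)"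
  proof
    fix c assume "c \<in> kernel Br (G\<lparr>carrier := E\<rparr>) e"
    then have c: "c \<in> K" "e c = \<one>"
      by (auto simp: kernel_def)
    have "lambda_map Br c k = (\<lambda>k\<in>K. k) k" for k
      using c by (cases "k \<in> K") (simp_all add: lambda_map_brace_of, simp add: lambda_map_def)
    then show "c \<in> kernel Br (AutoGroup (add_monoid Br)) (lambda_map Br)"
      using c by (auto simp: kernel_def AutoGroup_def BijGroup_def)
  qed
qed

lemma mult_iso_semidirect_product:
  "(\<lambda>(k, f). k \<otimes> f) \<in> iso (semidirect_product (add_monoid Br) (G\<lparr>carrier := E\<rparr>) conj_on_K) G"
proof (rule isoI)
  show "(\<lambda>(k, f). k \<otimes> f) \<in> hom (semidirect_product (add_monoid Br) (G\<lparr>carrier := E\<rparr>) conj_on_K) G"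
    by (auto simp: hom_def semidirect_product_def m_assoc inv_mult_cancel)
  have "inj_on (\<lambda>(k, f). k \<otimes> f) (K \<times> E)"
    using trivial_Int_factors_unique[OF K.subgroup_axioms subgroup_E K_Int_E]
    by (auto simp: inj_on_def)
  moreover have "(\<lambda>(k, f). k \<otimes> f) ` (K \<times> E) = carrier G"
    unfolding G_eq_KE set_mult_def by auto
  ultimately show "bij_betw (\<lambda>(k, f). k \<otimes> f)
      (carrier (semidirect_product (add_monoid Br) (G\<lparr>carrier := E\<rparr>) conj_on_K)) (carrier G)"
    by (simp add: bij_betw_def semidirect_product_def)
qed

lemma H_eq_E_part_graph: "H = (\<lambda>k. k \<otimes> e k) ` K"
proof (intro equalityI subsetI)
  fix h assume h: "h \<in> H"
  then obtain k f where kf: "k \<in> K" "f \<in> E" "h = k \<otimes> f"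
    using G_eq_KE H.mem_carrier unfolding set_mult_def by blast
  then have "e k = f"
    using h by (intro E_part_eqI) auto
  then show "h \<in> (\<lambda>k. k \<otimes> e k) ` K"
    using kf by blast
qed (auto simp: mult_E_part_in_H)

theorem associated_with_brace_of:
  "associated_trifactorised_group G K H E Br (G\<lparr>carrier := E\<rparr>) e conj_on_K (\<lambda>(k, f). k \<otimes> f)"
proof (intro associated_trifactorised_group.intro associated_trifactorised_group_axioms.intro)
  show "brace_extension_data Br (G\<lparr>carrier := E\<rparr>) e conj_on_K"
    by (rule brace_extension_data_brace_of)
  show "(\<lambda>(k, f). k \<otimes> f) \<in> iso (semidirect_product (add_monoid Br) (G\<lparr>carrier := E\<rparr>) conj_on_K) G"
    by (rule mult_iso_semidirect_product)
  show "K = (\<lambda>(k, f). k \<otimes> f) ` (carrier Br \<times> {\<one>\<^bsub>G\<lparr>carrier := E\<rparr>\<^esub>})"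
    by (force simp: image_iff)
  show "E = (\<lambda>(k, f). k \<otimes> f) ` ({\<zero>\<^bsub>Br\<^esub>} \<times> carrier (G\<lparr>carrier := E\<rparr>))"
    by (force simp: image_iff)
  show "H = (\<lambda>(k, f). k \<otimes> f) ` {(c, e c) |c. c \<in> carrier Br}"
    by (subst H_eq_E_part_graph) auto
qed (rule is_group)

end

section \<open>The trifactorised groups associated with a brace\<close>

lemma (in brace_extension_data) lambar_one:
  assumes "b \<in> carrier B"
  shows "lambar \<one>\<^bsub>E\<^sub>0\<^esub> b = b"
proof -
  have "\<eta> \<one> = \<one>\<^bsub>E\<^sub>0\<^esub>"
    using hom_one[OF eta_hom multiplicative_group E.is_group] .
  then show ?thesis
    using lambda_bar[of \<one>] lambda_map_one[OF assms] by simp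
qed

lemma (in brace_extension_data) lambar_closed:
  assumes "f \<in> carrier E\<^sub>0" "b \<in> carrier B"
  shows "lambar f b \<in> carrier B"
proof -
  obtain c where "c \<in> carrier B" "f = \<eta> c"
    using assms(1) eta_surj by blast
  then show ?thesis
    using assms(2) by (simp add: lambda_bar lambda_map_closed)
qed

lemma (in brace_extension_data) lambar_zero:
  assumes "f \<in> carrier E\<^sub>0"
  shows "lambar f \<zero> = \<zero>"
proof -
  obtain c where "c \<in> carrier B" "f = \<eta> c"
    using assms eta_surj by blast
  then show ?thesis
    by (simp add: lambda_bar lambda_map_zero)
qed

context associated_trifactorised_group
begin

lemma eta_closed [simp]: "c \<in> carrier B \<Longrightarrow> \<eta> c \<in> carrier E\<^sub>0"
  using eta_hom by (auto simp: hom_def)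

lemma eta_mult: "a \<in> carrier B \<Longrightarrow> b \<in> carrier B \<Longrightarrow> \<eta> (a \<otimes> b) = \<eta> a \<otimes>\<^bsub>E\<^sub>0\<^esub> \<eta> b"
  using eta_hom by (auto simp: hom_def)

lemma j_bij: "bij_betw j (carrier B \<times> carrier E\<^sub>0) (carrier G)"
  using j_iso by (simp add: iso_def semidirect_product_def)

lemma j_closed [simp]:
  assumes "a \<in> carrier B" "f \<in> carrier E\<^sub>0"
  shows "j (a, f) \<in> carrier G"
  using j_bij assms by (auto simp: bij_betw_def)

lemma j_eq_iff:
  assumes "a \<in> carrier B" "f \<in> carrier E\<^sub>0" "b \<in> carrier B" "g \<in> carrier E\<^sub>0"
  shows "j (a, f) = j (b, g) \<longleftrightarrow> a = b \<and> f = g"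
  using j_bij assms by (auto simp: bij_betw_def inj_on_def)

lemma j_surj:
  assumes "x \<in> carrier G"
  obtains a f where "a \<in> carrier B" "f \<in> carrier E\<^sub>0" "x = j (a, f)"
proof -
  have "x \<in> j ` (carrier B \<times> carrier E\<^sub>0)"
    using j_bij assms by (simp add: bij_betw_def)
  then show thesis
    using that by blast
qed

lemma j_mult:
  assumes "a \<in> carrier B" "f \<in> carrier E\<^sub>0" "b \<in> carrier B" "g \<in> carrier E\<^sub>0"
  shows "j (a, f) \<otimes>\<^bsub>G\<^esub> j (b, g) = j (a \<oplus> lambar f b, f \<otimes>\<^bsub>E\<^sub>0\<^esub> g)"
  using j_iso assms by (auto simp: iso_def hom_def semidirect_product_def)

text \<open>An idempotent of \<open>G\<close> is trivial.\<close>

lemma j_one: "j (\<zero>, \<one>\<^bsub>E\<^sub>0\<^esub>) = \<one>\<^bsub>G\<^esub>"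
proof -
  have "j (\<zero>, \<one>\<^bsub>E\<^sub>0\<^esub>) \<otimes>\<^bsub>G\<^esub> j (\<zero>, \<one>\<^bsub>E\<^sub>0\<^esub>) = j (\<zero>, \<one>\<^bsub>E\<^sub>0\<^esub>)"
    by (simp add: j_mult lambar_zero)
  then show ?thesis
    by simp
qed

text \<open>The first component is \<open>a + \<lambda>\<^sub>a(b) = a b\<close>; in particular \<open>c \<mapsto> (c, \<eta> c)\<close> is a homomorphism from
  the multiplicative group of \<open>B\<close>.\<close>

lemma j_eta_mult:
  assumes "a \<in> carrier B" "b \<in> carrier B" "g \<in> carrier E\<^sub>0"
  shows "j (a, \<eta> a) \<otimes>\<^bsub>G\<^esub> j (b, g) = j (a \<otimes> b, \<eta> a \<otimes>\<^bsub>E\<^sub>0\<^esub> g)"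
  using assms by (simp add: j_mult lambda_bar add_lambda_map)

lemma j_one_mult:
  assumes "a \<in> carrier B" "b \<in> carrier B" "g \<in> carrier E\<^sub>0"
  shows "j (a, \<one>\<^bsub>E\<^sub>0\<^esub>) \<otimes>\<^bsub>G\<^esub> j (b, g) = j (a \<oplus> b, g)"
  using assms by (simp add: j_mult lambar_one)

text \<open>\<open>K\<close> is the kernel of the projection to the second component.\<close>

lemma K_normal: "K \<lhd> G"
proof -
  define \<pi> where "\<pi> x = snd (inv_into (carrier B \<times> carrier E\<^sub>0) j x)" for x
  have \<pi>_j: "\<pi> (j (a, f)) = f" if "a \<in> carrier B" "f \<in> carrier E\<^sub>0" for a f
    using that j_bij by (simp add: \<pi>_def bij_betw_def inv_into_f_f)
  have "\<pi> \<in> hom G E\<^sub>0"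
  proof (rule homI)
    fix x y assume "x \<in> carrier G" "y \<in> carrier G"
    then obtain a f b g where
      "a \<in> carrier B" "f \<in> carrier E\<^sub>0" "x = j (a, f)"
      "b \<in> carrier B" "g \<in> carrier E\<^sub>0" "y = j (b, g)"
      by (metis j_surj)
    then show "\<pi> (x \<otimes>\<^bsub>G\<^esub> y) = \<pi> x \<otimes>\<^bsub>E\<^sub>0\<^esub> \<pi> y"
      by (simp add: j_mult \<pi>_j lambar_closed)
  next
    fix x assume "x \<in> carrier G"
    then show "\<pi> x \<in> carrier E\<^sub>0"
      by (rule j_surj) (simp add: \<pi>_j)
  qed
  then interpret \<pi>: group_hom G E\<^sub>0 \<pi>
    by unfold_locales
  have "K = kernel G E\<^sub>0 \<pi>"
  proof (intro equalityI subsetI)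
    fix x assume x: "x \<in> kernel G E\<^sub>0 \<pi>"
    then obtain a f where "a \<in> carrier B" "f \<in> carrier E\<^sub>0" "x = j (a, f)"
      unfolding kernel_def using j_surj by blast
    then show "x \<in> K"
      using x by (simp add: K_eq kernel_def \<pi>_j)
  qed (auto simp: K_eq kernel_def \<pi>_j)
  then show ?thesis
    using \<pi>.normal_kernel by simp
qed

lemma E_subgroup: "subgroup E G"
proof -
  have "(\<lambda>f. j (\<zero>, f)) \<in> hom E\<^sub>0 G"
    by (rule homI) (simp_all add: j_mult lambar_zero)
  then interpret emb: group_hom E\<^sub>0 G "\<lambda>f. j (\<zero>, f)"
    by unfold_locales
  have "E = (\<lambda>f. j (\<zero>, f)) ` carrier E\<^sub>0"
    unfolding E_eq by auto
  then show ?thesis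
    using emb.img_is_subgroup by simp
qed

lemma H_subgroup: "subgroup H G"
proof -
  have "(\<lambda>c. j (c, \<eta> c)) \<in> hom B G"
    by (rule homI) (simp_all add: j_eta_mult eta_mult)
  then interpret emb: group_hom B G "\<lambda>c. j (c, \<eta> c)"
    by unfold_locales
  have "H = (\<lambda>c. j (c, \<eta> c)) ` carrier B"
    unfolding H_eq by auto
  then show ?thesis
    using emb.img_is_subgroup by simp
qed

lemma j_in_K: "a \<in> carrier B \<Longrightarrow> j (a, \<one>\<^bsub>E\<^sub>0\<^esub>) \<in> K"
  unfolding K_eq by simp

lemma j_in_E: "f \<in> carrier E\<^sub>0 \<Longrightarrow> j (\<zero>, f) \<in> E"
  unfolding E_eq by simp

lemma j_in_H: "c \<in> carrier B \<Longrightarrow> j (c, \<eta> c) \<in> H"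
  unfolding H_eq by blast

theorem is_trifactorised_group: "trifactorised_group G K H E"
proof (intro trifactorised_group.intro trifactorised_group_axioms.intro)
  have subgroup_K: "subgroup K G"
    using K_normal by (simp add: normal_imp_subgroup)
  have K_sub: "K \<subseteq> carrier G" and H_sub: "H \<subseteq> carrier G" and E_sub: "E \<subseteq> carrier G"
    using subgroup_K H_subgroup E_subgroup by (simp_all add: subgroup.subset)
  show "carrier G = K <#>\<^bsub>G\<^esub> E"
  proof (rule equalityI[OF _ G.set_mult_closed[OF K_sub E_sub]], rule subsetI)
    fix x assume "x \<in> carrier G"
    then obtain a f where af: "a \<in> carrier B" "f \<in> carrier E\<^sub>0" "x = j (a, f)"
      by (rule j_surj)
    then have "x = j (a, \<one>\<^bsub>E\<^sub>0\<^esub>) \<otimes>\<^bsub>G\<^esub> j (\<zero>, f)"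
      by (simp add: j_one_mult)
    then show "x \<in> K <#>\<^bsub>G\<^esub> E"
      using af j_in_K j_in_E unfolding set_mult_def by blast
  qed
  show "carrier G = K <#>\<^bsub>G\<^esub> H"
  proof (rule equalityI[OF _ G.set_mult_closed[OF K_sub H_sub]], rule subsetI)
    fix x assume "x \<in> carrier G"
    then obtain a f where af: "a \<in> carrier B" "f \<in> carrier E\<^sub>0" "x = j (a, f)"
      by (rule j_surj)
    then obtain c where c: "c \<in> carrier B" "f = \<eta> c"
      using eta_surj by blast
    then have "x = j (a \<oplus> \<ominus> c, \<one>\<^bsub>E\<^sub>0\<^esub>) \<otimes>\<^bsub>G\<^esub> j (c, \<eta> c)"
      using af by (simp add: j_one_mult add.m_assoc)
    moreover have "a \<oplus> \<ominus> c \<in> carrier B"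
      using af c by simp
    ultimately show "x \<in> K <#>\<^bsub>G\<^esub> H"
      using c j_in_K j_in_H unfolding set_mult_def by blast
  qed
  show "carrier G = H <#>\<^bsub>G\<^esub> E"
  proof (rule equalityI[OF _ G.set_mult_closed[OF H_sub E_sub]], rule subsetI)
    fix x assume "x \<in> carrier G"
    then obtain a f where af: "a \<in> carrier B" "f \<in> carrier E\<^sub>0" "x = j (a, f)"
      by (rule j_surj)
    define g where "g = inv\<^bsub>E\<^sub>0\<^esub> \<eta> a \<otimes>\<^bsub>E\<^sub>0\<^esub> f"
    have g: "g \<in> carrier E\<^sub>0" "\<eta> a \<otimes>\<^bsub>E\<^sub>0\<^esub> g = f"
      using af by (simp_all add: g_def E.inv_mult_cancel)
    then have "x = j (a, \<eta> a) \<otimes>\<^bsub>G\<^esub> j (\<zero>, g)"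
      using af by (simp add: j_mult lambar_zero)
    then show "x \<in> H <#>\<^bsub>G\<^esub> E"
      using af g j_in_H j_in_E unfolding set_mult_def by blast
  qed
  show "K \<inter> E = {\<one>\<^bsub>G\<^esub>}"
    unfolding K_eq E_eq by (auto simp: j_eq_iff j_one[symmetric])
  have "\<eta> \<zero> = \<one>\<^bsub>E\<^sub>0\<^esub>"
    unfolding zero_eq_one using hom_one[OF eta_hom multiplicative_group E.is_group] .
  then show "H \<inter> E = {\<one>\<^bsub>G\<^esub>}"
    unfolding H_eq E_eq by (force simp: j_eq_iff j_one[symmetric])
qed (rule G.is_group K_normal H_subgroup E_subgroup)+

sublocale tri: trifactorised_group G K H E
  by (rule is_trifactorised_group)

text \<open>This is the factorisation \<open>(b, 1)(0, \<eta> b) = (b, \<eta> b) \<in> H\<close>.\<close>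

lemma E_part_j:
  assumes "b \<in> carrier B"
  shows "E_part G H E (j (b, \<one>\<^bsub>E\<^sub>0\<^esub>)) = j (\<zero>, \<eta> b)"
  using assms by (intro tri.E_part_eqI) (simp_all add: j_in_E j_one_mult j_in_H)

lemma conj_j:
  assumes "f \<in> carrier E\<^sub>0" "b \<in> carrier B"
  shows "j (\<zero>, f) \<otimes>\<^bsub>G\<^esub> j (b, \<one>\<^bsub>E\<^sub>0\<^esub>) \<otimes>\<^bsub>G\<^esub> inv\<^bsub>G\<^esub> j (\<zero>, f) = j (lambar f b, \<one>\<^bsub>E\<^sub>0\<^esub>)"
  using assms by (simp add: G.inv_solve_right' j_mult lambar_one lambar_zero lambar_closed)

theorem j_ring_iso: "(\<lambda>b. j (b, \<one>\<^bsub>E\<^sub>0\<^esub>)) \<in> ring_iso B (brace_of G K H E)"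
proof (rule ring_iso_memI)
  fix a b assume ab: "a \<in> carrier B" "b \<in> carrier B"
  show "j (a \<oplus> b, \<one>\<^bsub>E\<^sub>0\<^esub>) = j (a, \<one>\<^bsub>E\<^sub>0\<^esub>) \<oplus>\<^bsub>brace_of G K H E\<^esub> j (b, \<one>\<^bsub>E\<^sub>0\<^esub>)"
    using ab by (simp add: j_one_mult)
  have "lambar (\<eta> a) b = lambda_map B a b"
    using ab by (simp add: lambda_bar)
  then show "j (a \<otimes> b, \<one>\<^bsub>E\<^sub>0\<^esub>) = j (a, \<one>\<^bsub>E\<^sub>0\<^esub>) \<otimes>\<^bsub>brace_of G K H E\<^esub> j (b, \<one>\<^bsub>E\<^sub>0\<^esub>)"
    using ab by (simp add: E_part_j conj_j lambar_closed lambda_map_closed j_one_mult add_lambda_map)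
next
  show "j (\<one>, \<one>\<^bsub>E\<^sub>0\<^esub>) = \<one>\<^bsub>brace_of G K H E\<^esub>"
    using j_one by (simp add: zero_eq_one)
  show "bij_betw (\<lambda>b. j (b, \<one>\<^bsub>E\<^sub>0\<^esub>)) (carrier B) (carrier (brace_of G K H E))"
  proof -
    have "(\<lambda>b. j (b, \<one>\<^bsub>E\<^sub>0\<^esub>)) ` carrier B = K"
      unfolding K_eq by auto
    then show ?thesis
      by (auto simp: bij_betw_def inj_on_def j_eq_iff)
  qed
qed (simp add: j_in_K)

end

section \<open>The correspondence between braces and trifactorised groups\<close>

theorem proposition3p4:
  shows
    "(\<forall>(G :: 'g monoid) K H E.
        trifactorised_group G K H E \<longrightarrow>
        (\<exists>\<eta> lambar. associated_trifactorised_group G K H E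
                  (brace_of G K H E) (G\<lparr>carrier := E\<rparr>) \<eta> lambar (\<lambda>(k, e). k \<otimes>\<^bsub>G\<^esub> e)))
     \<and>
     (\<forall>(B :: 'b ring) (E\<^sub>0 :: 'e monoid) \<eta> lambar (G :: 'h monoid) K H E j.
        skew_left_brace B \<longrightarrow>
        associated_trifactorised_group G K H E B E\<^sub>0 \<eta> lambar j \<longrightarrow>
        trifactorised_group G K H E \<and>
        (\<lambda>b. j (b, \<one>\<^bsub>E\<^sub>0\<^esub>)) \<in> ring_iso B (brace_of G K H E))"
proof (intro conjI allI impI)
  fix G :: "'g monoid" and K H E
  assume "trifactorised_group G K H E"
  then show "\<exists>\<eta> lambar. associated_trifactorised_group G K H E
      (brace_of G K H E) (G\<lparr>carrier := E\<rparr>) \<eta> lambar (\<lambda>(k, e). k \<otimes>\<^bsub>G\<^esub> e)"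
    by (intro exI) (rule trifactorised_group.associated_with_brace_of)
next
  fix B :: "'b ring" and E\<^sub>0 :: "'e monoid" and \<eta> lambar and G :: "'h monoid" and K H E j
  assume "associated_trifactorised_group G K H E B E\<^sub>0 \<eta> lambar j"
  then show "trifactorised_group G K H E"
    and "(\<lambda>b. j (b, \<one>\<^bsub>E\<^sub>0\<^esub>)) \<in> ring_iso B (brace_of G K H E)"
    by (rule associated_trifactorised_group.is_trifactorised_group
        associated_trifactorised_group.j_ring_iso)+
qed

end
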